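(* There exists a Lebesgue measurable set $\mathcal{S}\subseteq\mathbb{R}^2$ of infinite two-dimensional Lebesgue measure such that every convex polygon that has all of its sides congruent (i.e. of equal length) and all of its vertices in $\mathcal{S}$ has area strictly less than $1$.
   Context: A convex polygon may have any number $n\geq 3$ of vertices (sides). Only its vertices are required to lie in $\mathcal{S}$, not its sides or interior. The single set $\mathcal{S}$ works for all numbers of sides $n$ and all side lengths simultaneously. *)

theory Defs
  imports "HOL-Analysis.Analysis"
begin

text \<open>
  A convex polygon is a full-dimensional polytope in the plane (so it has at least three vertices).
  Its vertices are its extreme points and its sides are its edges in the sense of
  \<^const>\<open>edge_of\<close>. In particular the polygon is nondegenerate and all interior angles are
  strictly less than a straight angle.
\<close>

definition convex_polygon :: "(real^2) set \<Rightarrow> bool" where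
  "convex_polygon P \<longleftrightarrow> polytope P \<and> aff_dim P = 2"

definition vertices :: "(real^2) set \<Rightarrow> (real^2) set" where
  "vertices P = {v. v extreme_point_of P}"

text \<open>Every edge of a polytope is a closed segment, so the condition below concerns all sides.\<close>

definition congruent_sides :: "(real^2) set \<Rightarrow> bool" where
  "congruent_sides P \<longleftrightarrow>
    (\<exists>l. \<forall>a b. closed_segment a b edge_of P \<longrightarrow> dist a b = l)"

end

theory Submission
  imports Defs
begin

text \<open>
  The set is a thin hyperbolic cusp, the points with \<open>x \<ge> 1\<close> and \<open>0 \<le> y \<le> c / x\<close> for a small
  constant \<open>c\<close>. Its area diverges logarithmically (lemma \<open>emeasure_cusp\<close>), and the decay \<open>c / x\<close>
  is exactly strong enough to keep the product of length and height of a polygon bounded.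

  Let an equilateral polygon with vertices in the cusp have horizontal extent \<open>w\<close>. It lies in a box
  of height \<open>c\<close>, so its area is \<open>O(c\<^sup>2)\<close> as long as \<open>w < 8 * c\<close>. A longer polygon is very flat. The
  key claim (lemma \<open>middle_topmost_vertex\<close>) is that it then has a vertex \<open>p\<close> on its upper boundary
  at horizontal distance at least \<open>w / 8\<close> from both of its ends. Otherwise the upper boundary
  crosses the middle in a single edge, which is longer than \<open>3 * w / 4\<close>; by congruence all sides
  are that long, by flatness they are all nearly horizontal, and so every one of them crosses the
  vertical line through the middle. But at most two edges of a convex polygon can cross such a
  line, while there are at least three edges (lemmas \<open>third_edge\<close> and \<open>not_every_edge_crosses\<close>).

  Given \<open>p\<close>, convexity bounds all heights by eight times the height of \<open>p\<close>
  (lemma \<open>height_bound_from_topmost\<close>), because the polygon never goes below the horizontal axis.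
  As the first coordinate of \<open>p\<close> is at least \<open>w / 8\<close>, the height of \<open>p\<close> is at most \<open>8 * c / w\<close>,
  so the polygon lies in a box of area \<open>w * (64 * c / w) = 64 * c\<close>.
\<close>

section \<open>Edges of a convex polygon\<close>

lemma rel_frontier_convex_polygon:
  assumes "convex_polygon P"
  shows "rel_frontier P = \<Union> {E. E edge_of P}"
proof -
  have "F facet_of P \<longleftrightarrow> F edge_of P" for F
    using assms by (auto simp: convex_polygon_def facet_of_def edge_of_def)
  then show ?thesis
    using assms by (simp add: convex_polygon_def rel_frontier_of_polyhedron polytope_imp_polyhedron)
qed

lemma edge_is_segment_of_vertices:
  assumes "convex_polygon P" "E edge_of P"
  obtains p q where "E = closed_segment p q" "p \<in> vertices P" "q \<in> vertices P"
proof -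
  have P: "polytope P" using assms by (simp add: convex_polygon_def)
  have E: "E face_of P" "aff_dim E = 1" using assms by (auto simp: edge_of_def)
  have "polytope E" using P E(1) by (rule face_of_polytope_polytope)
  then obtain p q where pq: "E = closed_segment p q"
    by (metis E(2) aff_dim_empty collinear_aff_dim compact_convex_collinear_segment order_refl
        polytope_imp_compact polytope_imp_convex one_neq_neg_one)
  have "p extreme_point_of P" "q extreme_point_of P"
    using extreme_point_of_face[OF E(1)] pq by (auto simp: extreme_point_of_segment)
  then show thesis using that pq by (simp add: vertices_def)
qed

text \<open>
  A region cut out by only two half-planes is unbounded: some direction \<open>d\<close> runs parallel to the
  first boundary line and does not approach the second. A ray in that direction from a relative
  interior point must leave the bounded polygon through some other edge. Used twice, the lemma
  yields three different edges.
\<close>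

lemma third_edge:
  assumes P: "convex_polygon P" and E: "E edge_of P" and G: "G edge_of P"
  obtains F where "F edge_of P" "F \<noteq> E" "F \<noteq> G"
proof -
  have poly: "polytope P" and dim: "aff_dim P = 2" using P by (auto simp: convex_polygon_def)
  have "P \<noteq> {}" using dim by auto
  then obtain z where z: "z \<in> rel_interior P"
    using rel_interior_eq_empty poly polytope_imp_convex by blast
  then have zP: "z \<in> P" using rel_interior_subset by blast
  have affP: "affine hull P = UNIV" using dim aff_dim_eq_full[of P] by simp
  have supporting_line: "\<exists>a b. P \<subseteq> {x. a \<bullet> x \<le> b} \<and> H = P \<inter> {x. a \<bullet> x = b} \<and> a \<bullet> z < b"
    if H: "H edge_of P" for H
  proof -
    have "H face_of P" using H by (simp add: edge_of_def)
    then have "H exposed_face_of P"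
      using exposed_face_of_polyhedron poly polytope_imp_polyhedron by blast
    then obtain a b where ab: "P \<subseteq> {x. a \<bullet> x \<le> b}" "H = P \<inter> {x. a \<bullet> x = b}"
      by (auto simp: exposed_face_of_def)
    have "z \<notin> H"
      using z H rel_frontier_convex_polygon[OF P] by (auto simp: rel_frontier_def)
    then have "a \<bullet> z < b" using ab zP by (auto simp: order_less_le)
    then show ?thesis using ab by blast
  qed
  obtain a1 b1 where E1: "E = P \<inter> {x. a1 \<bullet> x = b1}" "a1 \<bullet> z < b1"
    using supporting_line[OF E] by blast
  obtain a2 b2 where G2: "G = P \<inter> {x. a2 \<bullet> x = b2}" "a2 \<bullet> z < b2"
    using supporting_line[OF G] by blast
  obtain d0 :: "real^2" where d0: "d0 \<noteq> 0" "a1 \<bullet> d0 = 0"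
    using orthogonal_to_vector_exists[of a1] by (auto simp: orthogonal_def)
  define d where "d = (if a2 \<bullet> d0 \<le> 0 then d0 else - d0)"
  have d: "d \<noteq> 0" "a1 \<bullet> d = 0" "a2 \<bullet> d \<le> 0" using d0 by (auto simp: d_def)
  obtain s where s: "0 < s" "z + s *\<^sub>R d \<in> rel_frontier P"
    using ray_to_rel_frontier[OF polytope_imp_bounded[OF poly] z, of d] d affP by (metis UNIV_I)
  then obtain F where F: "F edge_of P" "z + s *\<^sub>R d \<in> F"
    using rel_frontier_convex_polygon[OF P] by blast
  have "a1 \<bullet> (z + s *\<^sub>R d) < b1" using d E1 by (simp add: inner_add_right)
  moreover have "a2 \<bullet> (z + s *\<^sub>R d) < b2" using d G2 s
    by (simp add: inner_add_right) (smt (verit) mult_nonneg_nonpos)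
  ultimately have "z + s *\<^sub>R d \<notin> E" "z + s *\<^sub>R d \<notin> G" using E1(1) G2(1) by auto
  then show thesis using that[of F] F by blast
qed

text \<open>
  A face that contains an inner point of a segment of the polygon contains the whole segment, so
  the two faces contain each other.
\<close>

lemma face_of_eq_if_open_segments_meet:
  assumes "closed_segment p q face_of P" "closed_segment r s face_of P"
    and "t \<in> open_segment p q" "t \<in> open_segment r s"
  shows "closed_segment p q = closed_segment r s"
proof -
  have sub: "closed_segment u v \<subseteq> closed_segment u' v'"
    if "closed_segment u v face_of P" "closed_segment u' v' face_of P"
      "t \<in> open_segment u v" "t \<in> open_segment u' v'" for u v u' v'
  proof -
    have "u \<in> P" "v \<in> P" using that(1) face_of_imp_subset by auto
    then have "u \<in> closed_segment u' v' \<and> v \<in> closed_segment u' v'"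
      using face_ofD[OF that(2) that(3)] that(4) by (auto simp: open_segment_def)
    then show ?thesis by (simp add: closed_segment_subset)
  qed
  show ?thesis using sub[OF assms(1,2)] sub[OF assms(2,1)] assms(3,4) by blast
qed

lemma obtain_crossing_point:
  fixes p q :: "real^2"
  assumes "p$1 < m" "m < q$1"
  obtains t where "t \<in> open_segment p q" "t$1 = m"
proof
  define u where "u = (m - p$1) / (q$1 - p$1)"
  have u: "0 < u" "u < 1" using assms by (auto simp: u_def field_simps)
  show "(1 - u) *\<^sub>R p + u *\<^sub>R q \<in> open_segment p q"
    using u assms by (auto simp: in_segment)
  have "u * (q$1 - p$1) = m - p$1" using assms by (simp add: u_def)
  then show "((1 - u) *\<^sub>R p + u *\<^sub>R q)$1 = m" by (simp add: algebra_simps)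
qed

lemma three_points_on_vertical_line:
  fixes t1 t2 t3 :: "real^2"
  assumes "t1$1 = m" "t2$1 = m" "t3$1 = m" "t1$2 < t2$2" "t2$2 < t3$2"
  shows "t2 \<in> open_segment t1 t3"
proof -
  define u where "u = (t2$2 - t1$2) / (t3$2 - t1$2)"
  have u: "0 < u" "u < 1" using assms by (auto simp: u_def field_simps)
  have "u * (t3$2 - t1$2) = t2$2 - t1$2" using assms by (simp add: u_def)
  then have "t2 = (1 - u) *\<^sub>R t1 + u *\<^sub>R t3"
    using assms(1-3) by (simp add: vec_eq_iff forall_2 algebra_simps)
  then show ?thesis using u assms by (auto simp: in_segment)
qed

text \<open>
  Both endpoints are strictly off the line, so that the crossing point is an inner point of the
  segment, to which the defining property of a face applies.
\<close>

definition crosses :: "(real^2) set \<Rightarrow> real \<Rightarrow> bool" where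
  "crosses E m \<longleftrightarrow> (\<exists>p q. E = closed_segment p q \<and> p$1 < m \<and> m < q$1)"

lemma crosses_unique_point:
  assumes "crosses E m" "t \<in> E" "t' \<in> E" "t$1 = m" "t'$1 = m"
  shows "t = t'"
proof -
  obtain p q where E: "E = closed_segment p q" "p$1 < m" "m < q$1"
    using assms(1) by (auto simp: crosses_def)
  obtain u where u: "t = (1 - u) *\<^sub>R p + u *\<^sub>R q" using assms E by (auto simp: in_segment)
  obtain u' where u': "t' = (1 - u') *\<^sub>R p + u' *\<^sub>R q" using assms E by (auto simp: in_segment)
  have "u * (q$1 - p$1) = u' * (q$1 - p$1)"
    using assms(4,5) u u' by (simp add: algebra_simps)
  then show ?thesis using E u u' by simp
qed

text \<open>
  Three edges would meet the vertical line in three points. These are different, since edges that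
  share an inner point coincide. The edge through the middle one, being a face, would then contain
  the other two as well, although it meets the line only once.
\<close>

lemma not_every_edge_crosses:
  assumes P: "convex_polygon P" and E: "E edge_of P"
    and all: "\<And>F. F edge_of P \<Longrightarrow> crosses F m"
  shows False
proof -
  obtain F where F: "F edge_of P" "F \<noteq> E" using third_edge[OF P E E] by blast
  obtain G where G: "G edge_of P" "G \<noteq> E" "G \<noteq> F" using third_edge[OF P E F(1)] by blast
  have point: "\<exists>t\<in>H. t$1 = m \<and> (\<exists>p q. H = closed_segment p q \<and> t \<in> open_segment p q)"
    if H: "H edge_of P" for H
  proof -
    obtain p q where pq: "H = closed_segment p q" "p$1 < m" "m < q$1"
      using all[OF H] by (auto simp: crosses_def)
    obtain t where t: "t \<in> open_segment p q" "t$1 = m"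
      using obtain_crossing_point[OF pq(2,3)] by blast
    then have "t \<in> H" using pq(1) by (simp add: open_segment_def)
    then show ?thesis using t pq(1) by blast
  qed
  have distinct: "t$2 \<noteq> t'$2"
    if H: "H edge_of P" "H' edge_of P" "H \<noteq> H'" and tm: "t$1 = m" "t'$1 = m"
      and t: "\<exists>p q. H = closed_segment p q \<and> t \<in> open_segment p q"
      and t': "\<exists>p q. H' = closed_segment p q \<and> t' \<in> open_segment p q" for H H' t t'
  proof
    assume "t$2 = t'$2"
    then have "t = t'" using tm by (simp add: vec_eq_iff forall_2)
    moreover obtain p q where "H = closed_segment p q" "t \<in> open_segment p q" using t by blast
    moreover obtain r s where "H' = closed_segment r s" "t' \<in> open_segment r s" using t' by blast
    ultimately show False
      using H face_of_eq_if_open_segments_meet[of p q P r s t] by (auto simp: edge_of_def)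
  qed
  have not_between: "\<not> (t1$2 < t2$2 \<and> t2$2 < t3$2)"
    if H: "H edge_of P" and t: "t1 \<in> P" "t3 \<in> P" "t2 \<in> H"
      and tm: "t1$1 = m" "t2$1 = m" "t3$1 = m" for H t1 t2 t3
  proof
    assume less: "t1$2 < t2$2 \<and> t2$2 < t3$2"
    then have "t2 \<in> open_segment t1 t3"
      using three_points_on_vertical_line[of t1 m t2 t3] tm by blast
    then have "t1 \<in> H \<and> t3 \<in> H"
      using face_ofD[of H P t2 t1 t3] H t by (simp add: edge_of_def)
    then have "t1 = t3"
      using crosses_unique_point[OF all[OF H], of t1 t3] tm by blast
    then show False using less by auto
  qed
  obtain te where te: "te \<in> E" "te$1 = m" "\<exists>p q. E = closed_segment p q \<and> te \<in> open_segment p q"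
    using point[OF E] by blast
  obtain tf where tf: "tf \<in> F" "tf$1 = m" "\<exists>p q. F = closed_segment p q \<and> tf \<in> open_segment p q"
    using point[OF F(1)] by blast
  obtain tg where tg: "tg \<in> G" "tg$1 = m" "\<exists>p q. G = closed_segment p q \<and> tg \<in> open_segment p q"
    using point[OF G(1)] by blast
  have ne: "te$2 \<noteq> tf$2" "te$2 \<noteq> tg$2" "tf$2 \<noteq> tg$2"
    using distinct[OF E F(1) F(2)[symmetric] te(2) tf(2) te(3) tf(3)]
      distinct[OF E G(1) G(2)[symmetric] te(2) tg(2) te(3) tg(3)]
      distinct[OF F(1) G(1) G(3)[symmetric] tf(2) tg(2) tf(3) tg(3)] by auto
  have inP: "te \<in> P" "tf \<in> P" "tg \<in> P"
    using te(1) tf(1) tg(1) edge_of_imp_subset[OF E] edge_of_imp_subset[OF F(1)]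
      edge_of_imp_subset[OF G(1)] by auto
  show False
    using ne not_between[OF E inP(2,3) te(1) tf(2) te(2) tg(2)]
      not_between[OF E inP(3,2) te(1) tg(2) te(2) tf(2)]
      not_between[OF F(1) inP(1,3) tf(1) te(2) tf(2) tg(2)]
      not_between[OF F(1) inP(3,1) tf(1) tg(2) tf(2) te(2)]
      not_between[OF G(1) inP(1,2) tg(1) te(2) tg(2) tf(2)]
      not_between[OF G(1) inP(2,1) tg(1) tf(2) tg(2) te(2)]
    by linarith
qed

section \<open>The upper boundary\<close>

definition topmost :: "(real^2) set \<Rightarrow> real^2 \<Rightarrow> bool" where
  "topmost P t \<longleftrightarrow> t \<in> P \<and> (\<forall>z\<in>P. z$1 = t$1 \<longrightarrow> z$2 \<le> t$2)"

text \<open>A small move upwards leaves the polygon, so such a point is not interior.\<close>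

lemma topmost_on_edge:
  assumes P: "convex_polygon P" and t: "topmost P t"
  obtains E where "E edge_of P" "t \<in> E"
proof -
  have "affine hull P = UNIV"
    using P aff_dim_eq_full[of P] by (simp add: convex_polygon_def)
  then have int: "rel_interior P = interior P" by (rule rel_interior_interior)
  have "t \<notin> interior P"
  proof
    assume "t \<in> interior P"
    then obtain e where e: "0 < e" "cball t e \<subseteq> P" by (meson mem_interior_cball)
    have "t + e *\<^sub>R axis 2 1 \<in> cball t e" using e by (simp add: dist_norm)
    then have "t + e *\<^sub>R axis 2 1 \<in> P" using e by blast
    then have "(t + e *\<^sub>R axis 2 1)$2 \<le> t$2"
      using t by (auto simp: topmost_def axis_def)
    then show False using e by (simp add: axis_def)
  qed
  then have "t \<in> rel_frontier P"
    using t int closure_subset by (auto simp: rel_frontier_def topmost_def)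
  then show thesis using that rel_frontier_convex_polygon[OF P] by blast
qed

text \<open>
  If \<open>p\<close> could be raised within \<open>P\<close>, then so could the point \<open>t\<close> of the segment from \<open>p\<close> to \<open>q\<close>.
\<close>

lemma endpoint_topmost:
  fixes p q :: "real^2"
  assumes "convex P" "topmost P t" "t \<in> closed_segment p q" "t \<noteq> q" "p \<in> P" "q \<in> P"
  shows "topmost P p"
  unfolding topmost_def
proof (intro conjI ballI impI)
  show "p \<in> P" by fact
  fix z assume z: "z \<in> P" "z$1 = p$1"
  obtain u where u: "t = (1 - u) *\<^sub>R p + u *\<^sub>R q" "0 \<le> u" "u \<le> 1"
    using assms by (auto simp: in_segment)
  have "u \<noteq> 1" using u \<open>t \<noteq> q\<close> by auto
  then have u1: "0 < 1 - u" using u by simp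
  define t' where "t' = (1 - u) *\<^sub>R z + u *\<^sub>R q"
  have "t' \<in> P" using \<open>convex P\<close> z \<open>q \<in> P\<close> u by (simp add: t'_def convex_alt)
  moreover have "t'$1 = t$1" using z u by (simp add: t'_def)
  ultimately have "t'$2 \<le> t$2" using assms by (simp add: topmost_def)
  then have "(1 - u) * z$2 \<le> (1 - u) * p$2" using u by (simp add: t'_def)
  then show "z$2 \<le> p$2" using u1 by simp
qed

lemma topmost_exists:
  assumes P: "convex_polygon P" and l: "l \<in> P" "l$1 \<le> m" and r: "r \<in> P" "m \<le> r$1"
  obtains t where "topmost P t" "t$1 = m"
proof -
  have poly: "polytope P" using P by (simp add: convex_polygon_def)
  have cv: "convex P" and cp: "compact P"
    using poly polytope_imp_convex polytope_imp_compact by auto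
  let ?K = "P \<inter> {x. x$1 = m}"
  have "closed {x::real^2. x$1 = m}"
    by (intro closed_Collect_eq continuous_intros)
  then have "compact ?K" using cp by blast
  moreover have "?K \<noteq> {}"
    using connected_ivt_component_cart[OF convex_connected[OF cv] l(1) r(1) l(2) r(2)] by blast
  moreover have "continuous_on ?K (\<lambda>x. x$2)" by (intro continuous_intros)
  ultimately obtain t where "t \<in> ?K" "\<forall>y\<in>?K. y$2 \<le> t$2"
    using continuous_attains_sup[of ?K "\<lambda>x. x$2"] by blast
  then show thesis using that[of t] by (auto simp: topmost_def)
qed

text \<open>
  The segment from \<open>o'\<close> to \<open>z\<close> passes the vertical line through \<open>p\<close> at or below \<open>p\<close>. Since it starts
  at a nonnegative height, its height from there to \<open>z\<close> grows at most by the factor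
  by which the horizontal distance from \<open>o'\<close> grows.
\<close>

lemma height_bound_from_topmost:
  assumes cv: "convex P" and pos: "\<And>z. z \<in> P \<Longrightarrow> 0 \<le> z$2" and p: "topmost P p"
    and o: "o' \<in> P" and z: "z \<in> P"
    and between: "o'$1 < p$1 \<and> p$1 \<le> z$1 \<or> z$1 \<le> p$1 \<and> p$1 < o'$1"
    and wide: "\<bar>z$1 - o'$1\<bar> \<le> k * \<bar>p$1 - o'$1\<bar>"
  shows "z$2 \<le> k * p$2"
proof -
  define u where "u = (p$1 - o'$1) / (z$1 - o'$1)"
  have u: "0 < u" "u \<le> 1" using between by (auto simp: u_def field_simps)
  define y where "y = (1 - u) *\<^sub>R o' + u *\<^sub>R z"
  have "y \<in> P" using cv o z u by (simp add: y_def convex_alt)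
  moreover have "u * (z$1 - o'$1) = p$1 - o'$1" using between by (auto simp: u_def)
  then have "y$1 = p$1" by (simp add: y_def algebra_simps)
  ultimately have "y$2 \<le> p$2" using p by (simp add: topmost_def)
  moreover have "y$2 = (1 - u) * o'$2 + u * z$2" by (simp add: y_def)
  moreover have "0 \<le> (1 - u) * o'$2" using pos[OF o] u by simp
  ultimately have uz: "u * z$2 \<le> p$2" by linarith
  have "1 \<le> k * u" using between wide by (auto simp: u_def field_simps abs_if split: if_splits)
  then have "z$2 \<le> (k * u) * z$2" using pos[OF z] mult_right_mono[of 1 "k*u" "z$2"] by simp
  also have "\<dots> = k * (u * z$2)" by simp
  also have "\<dots> \<le> k * p$2" 
  proof (rule mult_left_mono[OF uz])
    show "0 \<le> k" using \<open>1 \<le> k * u\<close> u by (smt (verit) mult_neg_pos)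
  qed
  finally show ?thesis .
qed

text \<open>
  Flatness makes every long edge almost horizontal: an edge longer than \<open>3 * w / 4\<close> whose vertical
  extent is at most \<open>h \<le> w / 8\<close> has horizontal extent more than \<open>w / 2\<close>, and within a polygon of
  horizontal extent \<open>w\<close> it must therefore cross the middle.
\<close>

lemma middle_topmost_vertex:
  assumes P: "convex_polygon P" and cong: "congruent_sides P"
    and flat: "\<And>z. z \<in> P \<Longrightarrow> 0 \<le> z$2 \<and> z$2 \<le> h"
    and l: "l \<in> P" and r: "r \<in> P"
    and lr: "\<And>z. z \<in> P \<Longrightarrow> l$1 \<le> z$1 \<and> z$1 \<le> r$1"
    and w: "w = r$1 - l$1" "0 < w" "8 * h \<le> w"
  shows "\<exists>p\<in>vertices P. topmost P p \<and> l$1 + w/8 \<le> p$1 \<and> p$1 \<le> r$1 - w/8"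
proof (rule ccontr)
  assume "\<not> ?thesis"
  then have outer: "p$1 < l$1 + w/8 \<or> r$1 - w/8 < p$1" if "p \<in> vertices P" "topmost P p" for p
    using that by force
  have cv: "convex P" using P by (simp add: convex_polygon_def polytope_imp_convex)
  have vP: "vertices P \<subseteq> P" by (auto simp: vertices_def extreme_point_of_def)
  define m where "m = (l$1 + r$1) / 2"
  obtain t where t: "topmost P t" "t$1 = m"
    using topmost_exists[OF P l _ r, of m] w by (auto simp: m_def)
  obtain E where E: "E edge_of P" "t \<in> E" using topmost_on_edge[OF P t(1)] by blast
  obtain p q where pq: "E = closed_segment p q" "p \<in> vertices P" "q \<in> vertices P"
    using edge_is_segment_of_vertices[OF P E(1)] by blast
  have "l$1 + w/8 \<le> m" unfolding m_def using w by argo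
  moreover have "m \<le> r$1 - w/8" unfolding m_def using w by argo
  ultimately have "t \<notin> vertices P" using outer[of t] t by auto
  then have tpq: "t \<noteq> p" "t \<noteq> q" using pq by auto
  have "topmost P p" "topmost P q"
    using endpoint_topmost[OF cv t(1), of p q] endpoint_topmost[OF cv t(1), of q p] E pq tpq vP
    by (auto simp: closed_segment_commute)
  then have out: "p$1 < l$1 + w/8 \<or> r$1 - w/8 < p$1" "q$1 < l$1 + w/8 \<or> r$1 - w/8 < q$1"
    using outer pq by auto
  \<comment> \<open>The endpoints cannot both be near the same end, because \<open>m\<close> lies between them.\<close>
  have "m \<in> closed_segment (p$1) (q$1)"
  proof -
    obtain u where "t = (1 - u) *\<^sub>R p + u *\<^sub>R q" "0 \<le> u" "u \<le> 1"
      using E pq by (auto simp: in_segment)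
    then show ?thesis using t(2) by (auto simp: in_segment)
  qed
  then have "p$1 \<le> m \<and> m \<le> q$1 \<or> q$1 \<le> m \<and> m \<le> p$1"
    by (auto simp: closed_segment_eq_real_ivl split: if_splits)
  then have "3 * w / 4 < q$1 - p$1 \<or> 3 * w / 4 < p$1 - q$1"
    using out w unfolding m_def by argo
  then have "3 * w / 4 < \<bar>p$1 - q$1\<bar>" by linarith
  also have "\<dots> \<le> dist p q" using component_le_norm_cart[of "p - q" 1] by (simp add: dist_norm)
  finally have long: "3 * w / 4 < dist p q" .
  have "crosses F m" if F: "F edge_of P" for F
  proof -
    obtain p' q' where pq': "F = closed_segment p' q'" "p' \<in> vertices P" "q' \<in> vertices P"
      using edge_is_segment_of_vertices[OF P F] by blast
    have "dist p' q' = dist p q" using cong E F pq pq' unfolding congruent_sides_def by metis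
    moreover have "dist p' q' \<le> \<bar>p'$1 - q'$1\<bar> + \<bar>p'$2 - q'$2\<bar>"
      using norm_le_l1_cart[of "p' - q'"] by (simp add: dist_norm sum_2)
    moreover have "p' \<in> P" "q' \<in> P" using pq' vP by auto
    moreover from this have "\<bar>p'$2 - q'$2\<bar> \<le> h" using flat[of p'] flat[of q'] by auto
    ultimately have "w / 2 < \<bar>p'$1 - q'$1\<bar>" using long w by linarith
    then have "w / 2 < q'$1 - p'$1 \<or> w / 2 < p'$1 - q'$1" by linarith
    moreover have "l$1 \<le> p'$1 \<and> p'$1 \<le> r$1" "l$1 \<le> q'$1 \<and> q'$1 \<le> r$1"
      using lr pq' vP by auto
    ultimately have "p'$1 < m \<and> m < q'$1 \<or> q'$1 < m \<and> m < p'$1"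
      using w(1) unfolding m_def by argo
    then show ?thesis unfolding crosses_def pq'(1) using closed_segment_commute by blast
  qed
  then show False using not_every_edge_crosses[OF P E(1)] by blast
qed

section \<open>Area bounds\<close>

lemma measure_le_box:
  assumes "P \<in> sets lebesgue"
    and "\<And>z::real^2. z \<in> P \<Longrightarrow> a \<le> z$1 \<and> z$1 \<le> b \<and> 0 \<le> z$2 \<and> z$2 \<le> h"
    and "a \<le> b" "0 \<le> h"
  shows "measure lebesgue P \<le> (b - a) * h"
proof -
  let ?B = "cbox (vector [a, 0]) (vector [b, h]) :: (real^2) set"
  have "P \<subseteq> ?B" using assms by (force simp: mem_box_cart forall_2)
  then have "measure lebesgue P \<le> measure lebesgue ?B"
    using assms(1) by (intro measure_mono_fmeasurable) auto
  moreover have "?B \<noteq> {}" using assms by (simp add: interval_ne_empty_cart forall_2)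
  ultimately show ?thesis by (simp add: content_cbox_cart UNIV_2)
qed

section \<open>The hyperbolic cusp\<close>

definition cusp :: "real \<Rightarrow> (real^2) set" where
  "cusp c = {v. 1 \<le> v$1 \<and> 0 \<le> v$2 \<and> v$1 * v$2 \<le> c}"

lemma closed_cusp: "closed (cusp c)"
  unfolding cusp_def by (intro closed_Collect_conj closed_Collect_le continuous_intros)

text \<open>
  The cusp contains disjoint boxes of width \<open>2 ^ k\<close> and height \<open>c / 2 ^ (k + 1)\<close>, one over each
  dyadic interval, and they all have the same area \<open>c / 2\<close>.
\<close>

lemma emeasure_cusp:
  assumes "0 < c"
  shows "emeasure lebesgue (cusp c) = \<infinity>"
proof -
  define B :: "nat \<Rightarrow> (real^2) set" where
    "B k = box (vector [2^k, 0]) (vector [2^(Suc k), c / 2^(Suc k)])" for k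
  have B: "v \<in> B k \<longleftrightarrow> 2^k < v$1 \<and> v$1 < 2^(Suc k) \<and> 0 < v$2 \<and> v$2 < c / 2^(Suc k)" for v k
    by (auto simp: B_def mem_box_cart forall_2)
  have sub: "B k \<subseteq> cusp c" for k
  proof
    fix v assume v: "v \<in> B k"
    have "1 \<le> (2::real)^k" by simp
    then have "1 \<le> v$1" using v unfolding B by linarith
    moreover have "v$1 * v$2 \<le> 2^(Suc k) * (c / 2^(Suc k))"
      using v by (intro mult_mono) (auto simp: B simp del: power_Suc)
    ultimately show "v \<in> cusp c" using v unfolding B cusp_def mem_Collect_eq
      by (auto simp del: power_Suc simp: field_simps)
  qed
  have disj: "disjoint_family B"
  proof -
    have "B i \<inter> B j = {}" if "i < j" for i j
    proof -
      have "(2::real)^(Suc i) \<le> 2^j" using that by (intro power_increasing) auto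
      have "\<not> (v \<in> B i \<and> v \<in> B j)" for v
        using \<open>2 ^ Suc i \<le> 2 ^ j\<close> unfolding B by linarith
      then show ?thesis by blast
    qed
    then show ?thesis unfolding disjoint_family_on_def by (metis Int_commute linorder_neqE_nat)
  qed
  have meas: "emeasure lebesgue (B k) = ennreal (c / 2)" for k
  proof -
    have "emeasure lebesgue (B k) = emeasure lborel (B k)" by (simp add: B_def)
    also have "\<dots> = ennreal (measure lborel (cbox (vector [2^k, 0]) (vector [2^(Suc k), c / 2^(Suc k)] :: real^2)))"
      unfolding B_def using assms
      by (simp add: emeasure_lborel_box_eq measure_lborel_cbox_eq emeasure_lborel_cbox_eq)
    also have "\<dots> = ennreal (c / 2)"
      using assms by (subst content_cbox_cart) (auto simp: interval_ne_empty_cart forall_2 UNIV_2 field_simps)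
    finally show ?thesis .
  qed
  have "\<infinity> = (\<Sum>k::nat. ennreal (c / 2))"
  proof (rule ccontr)
    assume "\<not> ?thesis"
    then have "summable (\<lambda>k::nat. c / 2)"
      using assms by (intro summable_suminf_not_top) auto
    then show False using assms by (simp add: summable_const_iff)
  qed
  also have "\<dots> = (\<Sum>k. emeasure lebesgue (B k))" by (simp only: meas)
  also have "\<dots> = emeasure lebesgue (\<Union>k. B k)"
    by (rule suminf_emeasure[OF _ disj]) (auto simp: B_def)
  also have "\<dots> \<le> emeasure lebesgue (cusp c)"
    using sub closed_cusp by (intro emeasure_mono) auto
  finally show ?thesis by (simp add: top_unique)
qed

section \<open>Equilateral polygons with vertices in the cusp\<close>

text \<open>
  The cusp itself is not convex, but the vertices also lie in a convex half-strip, which therefore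
  contains the whole polygon.
\<close>

lemma polygon_in_strip:
  assumes P: "convex_polygon P" and V: "vertices P \<subseteq> cusp c" and "z \<in> P"
  shows "1 \<le> z$1 \<and> 0 \<le> z$2 \<and> z$2 \<le> c"
proof -
  let ?H = "{v::real^2. 1 \<le> v$1} \<inter> {v. 0 \<le> v$2} \<inter> {v. v$2 \<le> c}"
  have "v \<in> ?H" if "v \<in> vertices P" for v
  proof -
    have v: "1 \<le> v$1" "0 \<le> v$2" "v$1 * v$2 \<le> c" using that V by (auto simp: cusp_def)
    then have "1 * v$2 \<le> v$1 * v$2" by (intro mult_right_mono)
    then show ?thesis using v by simp
  qed
  moreover have "convex ?H"
    using convex_halfspace_ge[of 1 "axis 1 1 :: real^2"] convex_halfspace_ge[of 0 "axis 2 1 :: real^2"]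
      convex_halfspace_le[of "axis 2 1 :: real^2" c]
    by (intro convex_Int) (simp_all add: inner_axis')
  ultimately have "convex hull (vertices P) \<subseteq> ?H" by (intro hull_minimal) auto
  moreover have "P = convex hull (vertices P)"
    using P Krein_Milman_Minkowski[of P] unfolding convex_polygon_def vertices_def
    by (simp add: polytope_imp_compact polytope_imp_convex)
  ultimately show ?thesis using \<open>z \<in> P\<close> by blast
qed

text \<open>
  The two terms of the bound belong to the polygons of horizontal extent below and above \<open>8 * c\<close>.
\<close>

lemma area_equilateral_polygon_in_cusp:
  assumes P: "convex_polygon P" and cong: "congruent_sides P" and V: "vertices P \<subseteq> cusp c"
    and c: "0 < c"
  shows "measure lebesgue P \<le> max (8 * c\<^sup>2) (64 * c)"
proof -
  have poly: "polytope P" and cv: "convex P" and cp: "compact P" and ne: "P \<noteq> {}"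
    using P by (auto simp: convex_polygon_def polytope_imp_convex polytope_imp_compact)
  have meas: "P \<in> sets lebesgue" using cp by (intro lmeasurable_compact fmeasurableD)
  note strip = polygon_in_strip[OF P V]
  have cont: "continuous_on P (\<lambda>x. x$1)" by (intro continuous_intros)
  obtain l where l: "l \<in> P" "\<And>z. z \<in> P \<Longrightarrow> l$1 \<le> z$1"
    using continuous_attains_inf[OF cp ne cont] by blast
  obtain r where r: "r \<in> P" "\<And>z. z \<in> P \<Longrightarrow> z$1 \<le> r$1"
    using continuous_attains_sup[OF cp ne cont] by blast
  define w where "w = r$1 - l$1"
  have w0: "0 \<le> w" using l(2)[OF r(1)] by (simp add: w_def)
  show ?thesis
  proof (cases "w < 8 * c")
    case True
    have "measure lebesgue P \<le> w * c"
      unfolding w_def using strip l r c by (intro measure_le_box[OF meas]) auto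
    also have "\<dots> \<le> (8 * c) * c" using True c by (intro mult_right_mono) auto
    finally show ?thesis by (simp add: power2_eq_square)
  next
    case False
    then have wc: "8 * c \<le> w" and wpos: "0 < w" using c by auto
    obtain p where p: "p \<in> vertices P" "topmost P p" "l$1 + w/8 \<le> p$1" "p$1 \<le> r$1 - w/8"
      using middle_topmost_vertex[OF P cong _ l(1) r(1) _ w_def wpos wc] strip l r by blast
    have pc: "1 \<le> p$1" "0 \<le> p$2" "p$1 * p$2 \<le> c" using p V by (auto simp: cusp_def)
    \<comment> \<open>Each point is compared with the extreme point of \<open>P\<close> on the opposite side of \<open>p\<close>.\<close>
    have low: "z$2 \<le> 8 * p$2" if z: "z \<in> P" for z
    proof (cases "p$1 \<le> z$1")
      case True
      have "l$1 < p$1" "z$1 - l$1 \<le> 8 * (p$1 - l$1)"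
        using p(3) r(2)[OF z] wpos w_def by argo+
      then show ?thesis
        by (intro height_bound_from_topmost[OF cv _ p(2) l(1) z])
          (use True strip l(2)[OF z] in auto)
    next
      case False
      have "p$1 < r$1" "r$1 - z$1 \<le> 8 * (r$1 - p$1)"
        using p(4) l(2)[OF z] wpos w_def by argo+
      then show ?thesis
        by (intro height_bound_from_topmost[OF cv _ p(2) r(1) z])
          (use False strip r(2)[OF z] in auto)
    qed
    have "measure lebesgue P \<le> w * (8 * p$2)"
      unfolding w_def using strip l r low pc by (intro measure_le_box[OF meas]) auto
    also have "\<dots> = 64 * ((w / 8) * p$2)" by simp
    also have "(w / 8) * p$2 \<le> p$1 * p$2"
      using p(3) strip[OF l(1)] pc by (intro mult_right_mono) auto
    also have "p$1 * p$2 \<le> c" by (rule pc)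
    finally show ?thesis by simp
  qed
qed

theorem theorem2:
  "\<exists>S :: (real^2) set. S \<in> sets lebesgue \<and> emeasure lebesgue S = \<infinity> \<and>
     (\<forall>P. convex_polygon P \<and> congruent_sides P \<and> vertices P \<subseteq> S
        \<longrightarrow> measure lebesgue P < 1)"
proof (intro exI conjI allI impI)
  show "cusp (1/100) \<in> sets lebesgue" using closed_cusp by auto
  show "emeasure lebesgue (cusp (1/100)) = \<infinity>" by (rule emeasure_cusp) simp
  fix P assume "convex_polygon P \<and> congruent_sides P \<and> vertices P \<subseteq> cusp (1/100)"
  then have "measure lebesgue P \<le> max (8 * (1/100)\<^sup>2) (64 * (1/100))"
    using area_equilateral_polygon_in_cusp[of P "1/100"] by simp
  then show "measure lebesgue P < 1" by (simp add: power2_eq_square)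
qed

end
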